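(* Let $u=(u_0,u_1,\dots)$ be an aperiodic, recurrent renewal sequence with lifetime distribution $f=(f_1,f_2,\dots)$, and for $N\ge1$ let $c_N:=f([N,\infty))=\sum_{n\ge N}f_n$ and $L(N):=\sum_{k=1}^Nc_k$. If $$\limsup_{N\to\infty}\frac{Nc_N}{L(N)}<\frac1{\sqrt5+1},$$ then $u$ is smooth, i.e. $$\sum_{k=1}^n|u_k-u_{k+1}|=o(a_n)\quad\text{as } n\to\infty,\qquad\text{where } a_n:=\sum_{k=1}^nu_k.$$
   Context: A sequence $u=(u_0,u_1,\dots)\in[0,1]^{\mathbb N_0}$ (with $\mathbb N_0=\{0,1,2,\dots\}$) is a renewal sequence if $u_0=1$ and there are numbers $f_1,f_2,\dots\ge0$ satisfying the renewal equation $u_n=\sum_{r=1}^nf_ru_{n-r}$ for all $n\ge1$. Then $\sum_{k\ge1}f_k\le1$, with equality if and only if $\sum_{n\ge0}u_n=\infty$; in the latter case $u$ is called recurrent and $f=(f_1,f_2,\dots)$, a probability distribution on $\mathbb N=\{1,2,\dots\}$, is called its lifetime distribution. The renewal sequence $u$ is aperiodic if $\gcd\{n\ge1:u_n>0\}=1$. *)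

theory Defs
  imports Complex_Main "HOL-Library.Extended_Real" "HOL-Library.Landau_Symbols"
begin

(* A lifetime sequence (f 1, f 2, ...) is a function on nat whose value at 0 is immaterial:
   it enters only tail f 0, which the theorem uses only in the N = 0 term of a limsup. *)

definition renewal_equation :: "(nat \<Rightarrow> real) \<Rightarrow> (nat \<Rightarrow> real) \<Rightarrow> bool" where
  "renewal_equation u f \<longleftrightarrow>
     (\<forall>r\<ge>1. 0 \<le> f r) \<and> (\<forall>n\<ge>1. u n = (\<Sum>r=1..n. f r * u (n - r)))"

definition renewal_sequence :: "(nat \<Rightarrow> real) \<Rightarrow> bool" where
  "renewal_sequence u \<longleftrightarrow>
     (\<forall>n. u n \<in> {0..1}) \<and> u 0 = 1 \<and> (\<exists>f. renewal_equation u f)"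

definition aperiodic :: "(nat \<Rightarrow> real) \<Rightarrow> bool" where
  "aperiodic u \<longleftrightarrow> Gcd {n. n \<ge> 1 \<and> u n > 0} = 1"

definition recurrent :: "(nat \<Rightarrow> real) \<Rightarrow> bool" where
  "recurrent u \<longleftrightarrow> filterlim (\<lambda>n. \<Sum>k\<le>n. u k) at_top sequentially"

(* For a recurrent renewal sequence u, the values f 1, f 2, ... are determined by u
   and sum to 1; this is a consequence and is not assumed here. *)
definition lifetime_distribution :: "(nat \<Rightarrow> real) \<Rightarrow> (nat \<Rightarrow> real) \<Rightarrow> bool" where
  "lifetime_distribution u f \<longleftrightarrow>
     renewal_sequence u \<and> recurrent u \<and> renewal_equation u f"

definition tail :: "(nat \<Rightarrow> real) \<Rightarrow> nat \<Rightarrow> real" where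
  "tail f N = (\<Sum>n. f (N + n))"

definition tail_sum :: "(nat \<Rightarrow> real) \<Rightarrow> nat \<Rightarrow> real" where
  "tail_sum f N = (\<Sum>k=1..N. tail f k)"

definition smooth_sequence :: "(nat \<Rightarrow> real) \<Rightarrow> bool" where
  "smooth_sequence u \<longleftrightarrow>
     (\<lambda>n. \<Sum>k=1..n. \<bar>u k - u (k + 1)\<bar>) \<in> o[sequentially](\<lambda>n. \<Sum>k=1..n. u k)"

end

(* Put C(z) = sum_k c_{k+1} z^k and V(z) = 1 + sum_{k>=1} (u_k - u_{k-1}) z^k. The renewal equation
   gives C V = 1 on the open unit disk. If |C| is bounded below there, V is bounded, so by Parseval
   the increments of u are square summable and sum_{k<=n} |u_k - u_{k+1}| = O(sqrt n).
   Away from 1 the lower bound on C comes from (1 - z) C(z) = 1 - sum_r f_r z^r, aperiodicity and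
   compactness. Near 1, for z = r e^{i t}, the coefficients c_{k+1} r^k are still decreasing and inherit
   N c_N <= g L(N); cutting Re C(z) at N with N t in about [pi/4, pi/2], the terms below N contribute at
   least a constant times L, and the tail takes away at most a fraction of this when g < 1/2.
   The same ratio condition gives L(N) = O(N^g), and a_n + 1 >= (n + 1) / L(n + 1) >> sqrt n.
   The value g = 1/3 > 1/(sqrt 5 + 1) is used throughout. *)
theory Submission
  imports Defs "HOL-Analysis.Analysis" "HOL-Real_Asymp.Real_Asymp"
begin

section \<open>Cosine series with decreasing coefficients\<close>

text \<open>Abel summation in inductive form: the partial sums of \<open>b\<close>, shifted by
  \<open>B\<close>, are nonnegative, so replacing the weight \<open>d n\<close> by the smaller
  \<open>d (Suc n)\<close> only lowers their product. The accumulated loss is at most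
  \<open>B * d 0\<close>.\<close>

lemma summation_by_parts_lower_bound:
  fixes d b :: "nat \<Rightarrow> real"
  assumes "decseq d" and "\<And>k. 0 \<le> d k" and S: "\<And>n. - B \<le> (\<Sum>k<n. b k)"
  shows "- B * d 0 \<le> (\<Sum>k<n. d k * b k)"
proof -
  have "d n * ((\<Sum>k<n. b k) + B) - B * d 0 \<le> (\<Sum>k<n. d k * b k)"
  proof (induction n)
    case (Suc n)
    have "d (Suc n) * ((\<Sum>k<Suc n. b k) + B) \<le> d n * ((\<Sum>k<Suc n. b k) + B)"
      using S[of "Suc n"] \<open>decseq d\<close> by (intro mult_right_mono) (auto simp: decseq_Suc_iff)
    with Suc show ?case by (simp add: algebra_simps)
  qed simp
  moreover have "0 \<le> d n * ((\<Sum>k<n. b k) + B)"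
    using S[of n] assms(2)[of n] by (intro mult_nonneg_nonneg) auto
  ultimately show ?thesis by simp
qed

text \<open>The Dirichlet kernel identity: the factor \<open>2 * sin (\<theta> / 2)\<close> makes
  the sum telescope. The starting index is free because both the head (from 0) and the tail (from
  \<open>N\<close>) of a cosine series are estimated with it.\<close>

lemma sum_cos_shifted:
  fixes \<theta> :: real
  shows "2 * sin (\<theta> / 2) * (\<Sum>k<n. cos (real (N + k) * \<theta>))
       = sin ((real (N + n) - 1/2) * \<theta>) - sin ((real N - 1/2) * \<theta>)"
proof (induction n)
  case (Suc n)
  have "2 * sin (\<theta> / 2) * cos (real (N + n) * \<theta>)
      = sin (real (N + n) * \<theta> + \<theta> / 2) - sin (real (N + n) * \<theta> - \<theta> / 2)"
    by (simp add: sin_add sin_diff)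
  also have "real (N + n) * \<theta> + \<theta> / 2 = (real (N + Suc n) - 1/2) * \<theta>"
    by (simp add: algebra_simps)
  also have "real (N + n) * \<theta> - \<theta> / 2 = (real (N + n) - 1/2) * \<theta>"
    by (simp add: algebra_simps)
  finally show ?case using Suc by (simp add: distrib_left)
qed simp

text \<open>Chebyshev's sum inequality handles \<open>k < N\<close>, summation by parts the rest.\<close>

lemma cosine_series_lower_bound:
  fixes d :: "nat \<Rightarrow> real" and \<theta> \<gamma> :: real
  assumes dec: "decseq d" and nn: "\<And>k. 0 \<le> d k" and sm: "summable d"
    and \<theta>: "0 < \<theta>" "\<theta> < pi" and N: "0 < N" "real N * \<theta> \<le> pi"
    and ratio: "real N * d N \<le> \<gamma> * (\<Sum>k<N. d k)"
  shows "(sin ((real N - 1/2) * \<theta>) - 2 * \<gamma>) / (2 * real N * sin (\<theta> / 2)) * (\<Sum>k<N. d k)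
         \<le> (\<Sum>k. d k * cos (real k * \<theta>))"
proof -
  define s where "s = 2 * sin (\<theta> / 2)"
  define S where "S = (\<Sum>k<N. d k)"
  have s: "0 < s" using \<theta> by (simp add: s_def sin_gt_zero)
  have smc: "summable (\<lambda>k. d k * cos (real k * \<theta>))"
    by (rule summable_comparison_test'[OF sm, of 0])
       (use nn in \<open>auto simp: abs_mult intro!: mult_left_le\<close>)
  \<comment> \<open>Starting at index 0, the lower boundary term is
    \<open>sin (\<theta> / 2) = s / 2\<close>. It is positive and is dropped.\<close>
  have "(real 0 - 1/2) * \<theta> = - (\<theta> / 2)" by simp
  then have "s * (\<Sum>k<N. cos (real k * \<theta>)) = sin ((real N - 1/2) * \<theta>) + s / 2"
    using sum_cos_shifted[of \<theta> 0 N] unfolding s_def by (simp only: sin_minus add_0)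
  then have "sin ((real N - 1/2) * \<theta>) \<le> s * (\<Sum>k<N. cos (real k * \<theta>))"
    using s by linarith
  then have cs: "sin ((real N - 1/2) * \<theta>) / s \<le> (\<Sum>k<N. cos (real k * \<theta>))"
    using s by (simp add: field_simps)
  \<comment> \<open>Both \<open>d\<close> and the cosines decrease, the latter because
    \<open>N * \<theta>\<close> does not exceed pi. The library inequality is for oppositely
    monotone sequences, hence the sign on \<open>d\<close>.\<close>
  have "real N * (\<Sum>k=0..<N. - d k * cos (real k * \<theta>))
      \<le> (\<Sum>k=0..<N. - d k) * (\<Sum>k=0..<N. cos (real k * \<theta>))"
  proof (rule Chebyshev_sum_upper)
    show "\<And>i j. i \<le> j \<Longrightarrow> j < N \<Longrightarrow> - d i \<le> - d j" using dec by (auto simp: decseq_def)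
    fix i j assume ij: "i \<le> j" "j < N"
    have "real j * \<theta> \<le> real N * \<theta>" using ij \<theta> by simp
    then have "real j * \<theta> \<le> pi" using N by linarith
    then show "cos (real j * \<theta>) \<le> cos (real i * \<theta>)"
      using ij \<theta> N by (intro cos_monotone_0_pi_le) auto
  qed
  then have "S * (\<Sum>k<N. cos (real k * \<theta>)) \<le> real N * (\<Sum>k<N. d k * cos (real k * \<theta>))"
    by (simp add: S_def sum_negf atLeast0LessThan)
  moreover have "S * (sin ((real N - 1/2) * \<theta>) / s) \<le> S * (\<Sum>k<N. cos (real k * \<theta>))"
    using cs by (intro mult_left_mono) (auto simp: S_def nn sum_nonneg)
  ultimately have head:
    "S * (sin ((real N - 1/2) * \<theta>) / s) \<le> real N * (\<Sum>k<N. d k * cos (real k * \<theta>))" by linarith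
  \<comment> \<open>A difference of two sines is at least -2, so every cosine block starting at
    \<open>N\<close> sums to at least \<open>- (2 / s)\<close>. Through \<open>ratio\<close> this
    becomes the \<open>2 * \<gamma>\<close> of the conclusion.\<close>
  have "- (2 / s) * d N \<le> (\<Sum>k<n. d (N + k) * cos (real (N + k) * \<theta>))" for n
  proof -
    have "- (2 / s) \<le> (\<Sum>k<m. cos (real (N + k) * \<theta>))" for m
    proof -
      have "- 2 \<le> s * (\<Sum>k<m. cos (real (N + k) * \<theta>))"
        unfolding s_def sum_cos_shifted
        using sin_ge_minus_one[of "(real (N + m) - 1/2) * \<theta>"] sin_le_one[of "(real N - 1/2) * \<theta>"]
        by linarith
      then show ?thesis using s by (simp add: field_simps)
    qed
    from summation_by_parts_lower_bound[of "\<lambda>k. d (N + k)", OF _ _ this]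
    show ?thesis using dec nn by (auto simp: decseq_def)
  qed
  moreover have "summable (\<lambda>k. d (N + k) * cos (real (N + k) * \<theta>))"
    using smc summable_iff_shift[of "\<lambda>k. d k * cos (real k * \<theta>)" N] by (simp add: add.commute)
  ultimately have "- (2 / s) * d N \<le> (\<Sum>k. d (N + k) * cos (real (N + k) * \<theta>))"
    by (intro LIMSEQ_le_const[OF summable_LIMSEQ]) auto
  then have "real N * (- (2 / s) * d N) \<le> real N * (\<Sum>k. d (N + k) * cos (real (N + k) * \<theta>))"
    by (intro mult_left_mono) auto
  moreover have "- (2 / s) * (\<gamma> * S) \<le> - (2 / s) * (real N * d N)"
    using ratio s by (intro mult_left_mono_neg) (auto simp: S_def)
  ultimately have "S * (sin ((real N - 1/2) * \<theta>) / s) - 2 / s * (\<gamma> * S)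
      \<le> real N * ((\<Sum>k. d (N + k) * cos (real (N + k) * \<theta>)) + (\<Sum>k<N. d k * cos (real k * \<theta>)))"
    using head by (simp add: algebra_simps)
  also have "\<dots> = real N * (\<Sum>k. d k * cos (real k * \<theta>))"
    using suminf_split_initial_segment[OF smc, of N] by (simp add: add.commute)
  finally show ?thesis
    using s N by (simp add: S_def[symmetric] s_def field_simps)
qed

section \<open>Lower bound for the tail series near 1\<close>

lemma summable_bounded_power_series:
  fixes c :: "nat \<Rightarrow> real" and z :: complex
  assumes "\<And>k. \<bar>c k\<bar> \<le> K" and "norm z < 1"
  shows "summable (\<lambda>k. norm (of_real (c k) * z ^ k))"
proof (rule summable_comparison_test'[of "\<lambda>k. K * norm z ^ k" 0])
  show "summable (\<lambda>k. K * norm z ^ k)"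
    using assms(2) by (intro summable_mult summable_geometric) simp
  show "norm (norm (of_real (c n) * z ^ n)) \<le> K * norm z ^ n" for n
    using assms(1)[of n] by (simp add: norm_mult norm_power mult_right_mono)
qed

text \<open>The constant is (7/10 - 2/3) / 3: the sine at the cut is at least sin(pi/4) > 7/10, the
  loss is 2 * (1/3), the denominator \<open>2 * N * sin (\<theta> / 2)\<close> is at most
  \<open>N * \<theta>\<close>, hence at most 3, and the head sum is at least
  \<open>d 0 = 1\<close>.\<close>

lemma Re_power_series_lower_bound_near_1:
  fixes c :: "nat \<Rightarrow> real"
  assumes dec: "decseq c" and nn: "\<And>k. 0 \<le> c k" and c0: "c 0 = 1"
    and ratio: "\<And>N. N \<ge> N0 \<Longrightarrow> real N * c N \<le> 1/3 * (\<Sum>k<N. c k)"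
  shows "\<exists>\<epsilon>>0. \<forall>z. norm z < 1 \<and> dist z 1 < \<epsilon> \<longrightarrow> 1/90 \<le> Re (\<Sum>k. of_real (c k) * z ^ k)"
proof -
  \<comment> \<open>Angles below \<open>\<theta>0\<close> push the cut \<open>N\<close> past
    \<open>N0\<close>, where \<open>ratio\<close> applies; \<open>\<theta>0 \<le> 1/2\<close> keeps
    the rounding error in \<open>N * \<theta>\<close> small.\<close>
  define \<theta>0 where "\<theta>0 = 1 / (2 * (real N0 + 1))"
  have \<theta>0: "0 < \<theta>0" "\<theta>0 \<le> 1/2" by (auto simp: \<theta>0_def field_simps)
  have "isCont Arg 1" by (rule continuous_at_Arg) auto
  then have "(Arg \<longlongrightarrow> Arg 1) (nhds 1)"
    unfolding isCont_def tendsto_at_iff_tendsto_nhds .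
  then have "\<forall>\<^sub>F z in nhds 1. dist (Arg z) (Arg 1) < \<theta>0" using \<theta>0(1) by (rule tendstoD)
  then obtain \<epsilon> where \<epsilon>: "\<epsilon> > 0" "\<And>z. dist z 1 < \<epsilon> \<Longrightarrow> \<bar>Arg z\<bar> < \<theta>0"
    unfolding eventually_nhds_metric by (auto simp: dist_real_def Arg_of_real)
  have c1: "\<bar>c k\<bar> \<le> 1" for k using nn[of k] decseqD[OF dec, of 0 k] c0 by simp
  have "1/90 \<le> Re (\<Sum>k. of_real (c k) * z ^ k)" if z: "norm z < 1" "dist z 1 < \<epsilon>" for z
  proof -
    define r where "r = norm z"
    define \<theta> where "\<theta> = \<bar>Arg z\<bar>"
    define d where "d k = c k * r ^ k" for k
    have r: "0 \<le> r" "r < 1" using z by (auto simp: r_def)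
    have sm: "summable (\<lambda>k. of_real (c k) * z ^ k)"
      using summable_bounded_power_series[OF c1 z(1)] by (rule summable_norm_cancel)
    have Re_term: "Re (of_real (c k) * z ^ k) = d k * cos (real k * \<theta>)" for k
    proof -
      have "z = rcis r (Arg z)" by (simp add: r_def rcis_cmod_Arg)
      then have "z ^ k = rcis (r ^ k) (real k * Arg z)" by (metis DeMoivre2)
      moreover have "cos (real k * \<theta>) = cos (real k * Arg z)" by (simp add: \<theta>_def abs_if)
      ultimately show ?thesis by (simp add: d_def Re_rcis)
    qed
    have eq: "Re (\<Sum>k. of_real (c k) * z ^ k) = (\<Sum>k. d k * cos (real k * \<theta>))"
      unfolding Re_suminf[OF sm] Re_term ..
    have dnn: "0 \<le> d k" for k using nn r by (simp add: d_def)
    have "d (Suc k) \<le> d k" for k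
      using dec r nn by (auto simp: d_def decseq_Suc_iff intro!: mult_mono power_decreasing)
        (metis mult_left_le_one_le less_imp_le zero_le_power)
    then have ddec: "decseq d" by (simp add: decseq_Suc_iff)
    have dsm: "summable d"
      using summable_bounded_power_series[of c 1 "of_real r"] c1 r
      by (simp add: d_def[abs_def] norm_mult norm_power nn abs_mult)
    have d0: "d 0 = 1" by (simp add: d_def c0)
    show ?thesis
    proof (cases "\<theta> = 0")
      case True
      \<comment> \<open>On the nonnegative real axis all cosines are 1, so the first term suffices.
        A cut of order \<open>1 / \<theta>\<close> exists only off this axis.\<close>
      have "d 0 \<le> suminf d"
        using sum_le_suminf[OF dsm, of "{0}"] dnn by simp
      then show ?thesis using True d0 by (simp add: eq)
    next
      case False
      then have \<theta>: "0 < \<theta>" "\<theta> < \<theta>0" using \<epsilon>(2)[OF z(2)] by (auto simp: \<theta>_def)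
      \<comment> \<open>The least \<open>N\<close> with \<open>(N - 1/2) * \<theta>\<close> at least
        pi/4; the shift by 1/2 is the one in \<open>sum_cos_shifted\<close>.\<close>
      define N where "N = nat \<lceil>pi / (4 * \<theta>) + 1/2\<rceil>"
      have pi4: "pi < 3.2" using pi_approx by simp
      have Nlo: "pi / (4 * \<theta>) + 1/2 \<le> real N" unfolding N_def by linarith
      have "0 \<le> pi / (4 * \<theta>) + 1/2" using \<theta> by simp
      then have Nhi: "real N < pi / (4 * \<theta>) + 3/2" unfolding N_def by linarith
      have lo: "pi / 4 \<le> (real N - 1/2) * \<theta>" using Nlo \<theta> by (simp add: field_simps)
      have hi0: "real N * \<theta> < pi / 4 + 3/2 * \<theta>" using Nhi \<theta> by (simp add: field_simps)
      have hi: "(real N - 1/2) * \<theta> \<le> pi / 2"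
        using hi0 \<theta> \<theta>0 pi_gt3 by (simp add: algebra_simps)
      have N\<theta>: "real N * \<theta> \<le> 3" using hi0 \<theta> \<theta>0 pi4 by linarith
      have "real N0 + 1 \<le> 1 / (2 * \<theta>)"
        using \<theta> by (simp add: \<theta>0_def field_simps)
      also have "\<dots> \<le> pi / (4 * \<theta>)" using pi_gt3 \<theta> by (simp add: field_simps)
      finally have NN0: "N0 \<le> N" "0 < N" using Nlo by linarith+
      \<comment> \<open>For \<open>k < N\<close> the damping \<open>r ^ k\<close> is at least
        \<open>r ^ N\<close>, so \<open>d\<close> inherits the ratio condition from
        \<open>c\<close>, uniformly in \<open>r\<close>.\<close>
      have rN: "r ^ N * (\<Sum>k<N. c k) \<le> (\<Sum>k<N. d k)"
        unfolding sum_distrib_left d_def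
        using r nn by (intro sum_mono)
          (auto simp: mult.commute intro!: mult_left_mono power_decreasing)
      have "real N * d N = r ^ N * (real N * c N)" by (simp add: d_def)
      also have "\<dots> \<le> r ^ N * (1/3 * (\<Sum>k<N. c k))"
        using ratio[OF NN0(1)] r by (intro mult_left_mono) auto
      also have "\<dots> \<le> 1/3 * (\<Sum>k<N. d k)" using rN by simp
      finally have ratio': "real N * d N \<le> 1/3 * (\<Sum>k<N. d k)" .
      have *: "(sin ((real N - 1/2) * \<theta>) - 2 * (1/3)) / (2 * real N * sin (\<theta> / 2)) * (\<Sum>k<N. d k)
          \<le> (\<Sum>k. d k * cos (real k * \<theta>))"
        using \<theta> \<theta>0 NN0 N\<theta> pi_gt3
        by (intro cosine_series_lower_bound ddec dnn dsm ratio') auto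
      have "sin (pi / 4) \<le> sin ((real N - 1/2) * \<theta>)"
        using lo hi pi_gt3 by (intro sin_monotone_2pi_le) auto
      moreover have "7/10 \<le> sin (pi / 4)"
        using real_le_rsqrt[of "7/5" 2] by (simp add: sin_45 power2_eq_square)
      ultimately have sn: "1/30 \<le> sin ((real N - 1/2) * \<theta>) - 2 * (1/3)" by simp
      have "0 < sin (\<theta> / 2)" using \<theta> \<theta>0 pi_gt3 by (intro sin_gt_zero) auto
      then have den0: "0 < 2 * real N * sin (\<theta> / 2)" using NN0 by simp
      have "sin (\<theta> / 2) \<le> \<theta> / 2" using \<theta> by (intro sin_x_le_x) auto
      then have "2 * real N * sin (\<theta> / 2) \<le> 2 * real N * (\<theta> / 2)" by (intro mult_left_mono) auto
      then have den: "2 * real N * sin (\<theta> / 2) \<le> 3" using N\<theta> by simp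
      have "(1/30) / 3 \<le> (sin ((real N - 1/2) * \<theta>) - 2 * (1/3)) / (2 * real N * sin (\<theta> / 2))"
        using sn den den0 by (intro frac_le) auto
      moreover have "1 \<le> (\<Sum>k<N. d k)"
        using sum_mono2[of "{..<N}" "{0}" d] NN0 dnn d0 by auto
      ultimately have "(1/90) * 1 \<le>
          (sin ((real N - 1/2) * \<theta>) - 2 * (1/3)) / (2 * real N * sin (\<theta> / 2)) * (\<Sum>k<N. d k)"
        by (intro mult_mono) linarith+
      then show ?thesis using * eq by linarith
    qed
  qed
  then show ?thesis using \<epsilon>(1) by blast
qed

section \<open>Square sums of the coefficients of a bounded power series\<close>

text \<open>Orthogonality of the characters of Z/M: for \<open>k \<noteq> l\<close> this is a
  geometric sum whose ratio \<open>w\<close> satisfies \<open>w ^ M = 1\<close>, and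
  \<open>w \<noteq> 1\<close> because 0 < |k - l| < M.\<close>

lemma sum_cis_roots_of_unity:
  assumes "k < M" "l < M"
  shows "(\<Sum>j<M. cis (2 * pi * real j * (real k - real l) / real M)) = (if k = l then of_nat M else 0)"
proof (cases "k = l")
  case False
  define w where "w = cis (2 * pi * (real k - real l) / real M)"
  have M: "M > 0" using assms by auto
  have "(\<Sum>j<M. cis (2 * pi * real j * (real k - real l) / real M)) = (\<Sum>j<M. w ^ j)"
    unfolding w_def Complex.DeMoivre by (intro sum.cong arg_cong[where f = cis] refl) (simp add: field_simps)
  moreover have "w \<noteq> 1"
  proof
    assume "w = 1"
    then have "cos (2 * pi * (real k - real l) / real M) = 1"
      by (metis w_def cis.sel(1) one_complex.sel(1))
    then obtain m :: int where "2 * pi * (real k - real l) / real M = of_int m * 2 * pi"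
      using cos_one_2pi_int by blast
    then have "(2 * pi) * (real k - real l) = (2 * pi) * (of_int m * real M)"
      using M by (simp add: field_simps)
    then have "real k - real l = of_int m * real M" by (metis mult_cancel_left pi_neq_zero zero_neq_numeral no_zero_divisors)
    then have e: "int k - int l = m * int M"
      by (metis of_int_diff of_int_eq_iff of_int_mult of_int_of_nat_eq)
    then have "\<bar>m * int M\<bar> < int M" using assms by linarith
    then have "\<bar>m\<bar> < 1" using M by (simp add: abs_mult)
    then show False using e False by simp
  qed
  moreover have "w ^ M = 1"
  proof -
    have "w ^ M = cis (2 * pi * of_int (int k - int l))"
      using M by (simp add: w_def Complex.DeMoivre)
    then show ?thesis using cis_multiple_2pi[of "of_int (int k - int l)"] by auto
  qed
  ultimately show ?thesis using False by (simp add: geometric_sum)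
qed simp

text \<open>Parseval, with the circle replaced by the \<open>M\<close>-th roots of unity.\<close>

lemma sum_squares_le_sup_poly:
  fixes a :: "nat \<Rightarrow> real"
  assumes "0 \<le> r" and B: "\<And>z::complex. norm z = r \<Longrightarrow> norm (\<Sum>k<M. of_real (a k) * z ^ k) \<le> B"
  shows "(\<Sum>k<M. (a k * r ^ k)\<^sup>2) \<le> B\<^sup>2"
proof (cases "M = 0")
  case False
  \<comment> \<open>There are as many sample points as coefficients, so distinct exponents below
    \<open>M\<close> stay distinct modulo \<open>M\<close> and no cross terms survive.\<close>
  define p where "p j = (\<Sum>k<M. of_real (a k) * rcis r (2 * pi * real j / real M) ^ k)" for j
  define b where "b k = a k * r ^ k" for k
  have p: "p j = (\<Sum>k<M. of_real (b k) * cis (2 * pi * real j * real k / real M))" for j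
    unfolding p_def DeMoivre2 unfolding rcis_def b_def by (intro sum.cong refl) (simp add: mult_ac)
  have "of_real (\<Sum>j<M. (norm (p j))\<^sup>2) = (\<Sum>j<M. p j * cnj (p j))"
    by (simp only: of_real_sum complex_norm_square)
  also have "\<dots> = (\<Sum>j<M. \<Sum>k<M. \<Sum>l<M. of_real (b k * b l) *
       cis (2 * pi * real j * (real k - real l) / real M))"
    unfolding p cnj_sum sum_product
  proof (intro sum.cong refl)
    fix j k l
    have "2 * pi * real j * (real k - real l) / real M
        = 2 * pi * real j * real k / real M + - (2 * pi * real j * real l / real M)"
      by (simp add: right_diff_distrib diff_divide_distrib)
    then show "of_real (b k) * cis (2 * pi * real j * real k / real M) *
          cnj (of_real (b l) * cis (2 * pi * real j * real l / real M))
        = of_real (b k * b l) * cis (2 * pi * real j * (real k - real l) / real M)"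
      by (simp only: cis_mult[symmetric] cis_cnj complex_cnj_mult complex_cnj_complex_of_real
            of_real_mult mult_ac)
  qed
  also have "\<dots> = (\<Sum>k<M. \<Sum>j<M. \<Sum>l<M. of_real (b k * b l) *
       cis (2 * pi * real j * (real k - real l) / real M))"
    by (rule sum.swap)
  also have "\<dots> = (\<Sum>k<M. \<Sum>l<M. of_real (b k * b l) *
       (\<Sum>j<M. cis (2 * pi * real j * (real k - real l) / real M)))"
    unfolding sum_distrib_left by (rule sum.cong[OF refl], rule sum.swap)
  also have "\<dots> = (\<Sum>k<M. \<Sum>l<M. of_real (b k * b l) * (if k = l then of_nat M else 0))"
    by (intro sum.cong refl) (simp add: sum_cis_roots_of_unity)
  also have "\<dots> = of_real (real M * (\<Sum>k<M. (b k)\<^sup>2))"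
    by (simp add: if_distrib sum.delta' sum_distrib_left power2_eq_square mult_ac cong: if_cong)
  finally have "(\<Sum>j<M. (norm (p j))\<^sup>2) = real M * (\<Sum>k<M. (b k)\<^sup>2)"
    by (simp only: of_real_eq_iff)
  moreover have "(\<Sum>j<M. (norm (p j))\<^sup>2) \<le> (\<Sum>j<M. B\<^sup>2)"
    using B \<open>0 \<le> r\<close> by (intro sum_mono power_mono) (auto simp: p_def)
  ultimately show ?thesis using False by (simp add: b_def)
qed simp

text \<open>On the circle of radius \<open>r < 1\<close> the truncation at \<open>n\<close> differs
  from the series by at most the geometric remainder \<open>K * r ^ n / (1 - r)\<close>. With
  \<open>m\<close> fixed, first \<open>n\<close> tends to infinity, then \<open>r\<close> tends to
  1.\<close>

lemma sum_squares_le_sup_power_series: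
  fixes v :: "nat \<Rightarrow> real"
  assumes v: "\<And>k. \<bar>v k\<bar> \<le> K"
    and B: "\<And>z. norm z < 1 \<Longrightarrow> norm (\<Sum>k. of_real (v k) * z ^ k :: complex) \<le> B"
  shows "(\<Sum>k<m. (v k)\<^sup>2) \<le> B\<^sup>2"
proof -
  have r_bound: "(\<Sum>k<m. (v k * r ^ k)\<^sup>2) \<le> B\<^sup>2" if r: "0 < r" "r < 1" for r
  proof -
    have K: "0 \<le> K" using v[of 0] by linarith
    have "norm (\<Sum>k<n. of_real (v k) * z ^ k) \<le> B + K * r ^ n / (1 - r)"
      if z: "norm z = r" for n and z :: complex
    proof -
      have z1: "norm z < 1" using z r by simp
      note sn = summable_bounded_power_series[OF v z1]
      have sg: "summable (\<lambda>k. K * r ^ n * r ^ k)"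
        using r by (intro summable_mult summable_geometric) simp
      have le: "norm (of_real (v (k + n)) * z ^ (k + n)) \<le> K * r ^ n * r ^ k" for k
        using mult_right_mono[OF v[of "k + n"], of "r ^ (k + n)"] r
        by (simp add: norm_mult norm_power z power_add mult_ac)
      have "norm (\<Sum>k. of_real (v (k + n)) * z ^ (k + n)) \<le> (\<Sum>k. K * r ^ n * r ^ k)"
        by (rule norm_suminf_le[OF le sg])
      also have "\<dots> = K * r ^ n / (1 - r)"
        using r by (subst suminf_mult) (auto simp: suminf_geometric summable_geometric)
      finally have "norm (\<Sum>k. of_real (v (k + n)) * z ^ (k + n)) \<le> K * r ^ n / (1 - r)" .
      moreover have "(\<Sum>k<n. of_real (v k) * z ^ k)
          = (\<Sum>k. of_real (v k) * z ^ k) - (\<Sum>k. of_real (v (k + n)) * z ^ (k + n))"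
        using suminf_split_initial_segment[OF summable_norm_cancel[OF sn], where k = n] by simp
      ultimately show ?thesis
        using B[OF z1] norm_triangle_ineq4 by (smt (verit))
    qed
    then have "(\<Sum>k<n. (v k * r ^ k)\<^sup>2) \<le> (B + K * r ^ n / (1 - r))\<^sup>2" for n
      using r by (intro sum_squares_le_sup_poly) auto
    moreover have "(\<Sum>k<m. (v k * r ^ k)\<^sup>2) \<le> (\<Sum>k<n. (v k * r ^ k)\<^sup>2)" if "m \<le> n" for n
      using that by (intro sum_mono2) auto
    ultimately have "(\<Sum>k<m. (v k * r ^ k)\<^sup>2) \<le> (B + K * r ^ n / (1 - r))\<^sup>2" if "m \<le> n" for n
      using that order_trans by blast
    moreover have "(\<lambda>n. (B + K * r ^ n / (1 - r))\<^sup>2) \<longlonglongrightarrow> (B + K * 0 / (1 - r))\<^sup>2"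
      using r by (intro tendsto_intros LIMSEQ_power_zero) auto
    ultimately show ?thesis by (intro LIMSEQ_le_const) auto
  qed
  have "((\<lambda>r. \<Sum>k<m. (v k * r ^ k)\<^sup>2) \<longlongrightarrow> (\<Sum>k<m. (v k * 1 ^ k)\<^sup>2)) (at_left 1)"
    by (intro tendsto_intros)
  moreover have "\<forall>\<^sub>F r in at_left (1::real). (\<Sum>k<m. (v k * r ^ k)\<^sup>2) \<le> B\<^sup>2"
    using eventually_at_left_real[of 0 "1::real"] by (rule eventually_mono) (auto intro: r_bound)
  ultimately have "(\<Sum>k<m. (v k * 1 ^ k)\<^sup>2) \<le> B\<^sup>2"
    by (rule tendsto_upperbound) simp
  then show ?thesis by simp
qed

section \<open>Lifetimes and tails of a recurrent renewal sequence\<close>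

lemma renewal_partial_sums:
  assumes "renewal_equation u f" and "u 0 = 1"
  shows "(\<Sum>k\<le>M. u k) - 1 = (\<Sum>r=1..M. f r * (\<Sum>k\<le>M - r. u k))"
proof (induction M)
  case (Suc M)
  have "(\<Sum>r=1..Suc M. f r * (\<Sum>k\<le>Suc M - r. u k))
      = (\<Sum>r=1..M. f r * (\<Sum>k\<le>M - r. u k) + f r * u (Suc M - r)) + f (Suc M) * u 0"
    by (auto simp: Suc_diff_le distrib_left intro!: sum.cong)
  also have "\<dots> = (\<Sum>k\<le>M. u k) - 1 + (\<Sum>r=1..Suc M. f r * u (Suc M - r))"
    using Suc by (simp add: sum.distrib)
  also have "(\<Sum>r=1..Suc M. f r * u (Suc M - r)) = u (Suc M)"
    using assms(1) by (auto simp: renewal_equation_def)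
  finally show ?case by simp
qed (use assms in simp)

text \<open>Compare \<open>A (M - r)\<close> with \<open>A M\<close> in the renewal equation for the
  partial sums \<open>A\<close>. Since \<open>u \<le> 1\<close>, it is at least
  \<open>A M - r\<close>, which as \<open>A M\<close> grows excludes a partial sum of
  \<open>f\<close> above 1. Since it is at most \<open>A M\<close>, \<open>s M\<close> is at least
  \<open>1 - 1 / A M\<close>, and this tends to 1 by recurrence.\<close>

lemma recurrent_lifetime_sums_1:
  assumes "renewal_sequence u" and rec: "recurrent u" and eq: "renewal_equation u f"
  shows "(\<lambda>n. f (Suc n)) sums 1"
proof -
  define A where "A M = (\<Sum>k\<le>M. u k)" for M
  define s where "s M = (\<Sum>r=1..M. f r)" for M
  have u: "\<And>n. 0 \<le> u n" "\<And>n. u n \<le> 1" "u 0 = 1"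
    using assms(1) by (auto simp: renewal_sequence_def)
  have f: "0 \<le> f r" if "1 \<le> r" for r using eq that by (auto simp: renewal_equation_def)
  have A_eq: "A M - 1 = (\<Sum>r=1..M. f r * A (M - r))" for M
    unfolding A_def by (rule renewal_partial_sums[OF eq u(3)])
  have A_mono: "A m \<le> A n" if "m \<le> n" for m n
    unfolding A_def using that u by (intro sum_mono2) auto
  have A_diff: "A M - real r \<le> A (M - r)" if "r \<le> M" for r M
    using that
  proof (induction r)
    case (Suc r)
    then have e: "M - r = Suc (M - Suc r)" by simp
    have "A (M - r) \<le> A (M - Suc r) + 1" unfolding e A_def using u(2) by simp
    with Suc show ?case by simp
  qed simp
  have A1: "1 \<le> A M" for M using A_mono[of 0 M] u by (simp add: A_def)
  have A_top: "filterlim A at_top sequentially"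
    using rec by (simp add: recurrent_def A_def[abs_def])
  have "s R \<le> 1" for R
  proof (rule ccontr)
    assume "\<not> s R \<le> 1"
    then have sR: "1 < s R" by simp
    \<comment> \<open>The threshold is where \<open>s R * (A M - R)\<close> reaches
      \<open>A M\<close>, although it has to stay below \<open>A M - 1\<close>.\<close>
    have "\<forall>\<^sub>F M in sequentially. s R * real R / (s R - 1) \<le> A M \<and> R \<le> M"
      using A_top eventually_ge_at_top by (auto simp: filterlim_at_top intro: eventually_conj)
    then obtain M where M: "s R * real R / (s R - 1) \<le> A M" "R \<le> M"
      using eventually_happens trivial_limit_sequentially by blast
    have "s R * (A M - real R) \<le> (\<Sum>r=1..R. f r * A (M - r))"
      unfolding s_def sum_distrib_right
    proof (intro sum_mono mult_left_mono)
      fix r assume "r \<in> {1..R}"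
      then show "A M - real R \<le> A (M - r)" "0 \<le> f r" using A_diff[of r M] M f by auto
    qed
    also have "\<dots> \<le> (\<Sum>r=1..M. f r * A (M - r))"
      using M f A1 by (intro sum_mono2) (auto intro!: mult_nonneg_nonneg intro: order_trans[of 0 1])
    finally have "s R * (A M - real R) \<le> A M - 1" using A_eq by simp
    moreover have "s R * real R \<le> A M * (s R - 1)" using M sR by (simp add: field_simps)
    ultimately show False by (simp add: algebra_simps)
  qed
  moreover have "1 - inverse (A M) \<le> s M" for M
  proof -
    have "A M - 1 \<le> s M * A M"
      unfolding A_eq s_def sum_distrib_right using f A_mono by (intro sum_mono mult_left_mono) auto
    then show ?thesis using A1[of M] by (simp add: field_simps)
  qed
  moreover have "(\<lambda>M. 1 - inverse (A M)) \<longlonglongrightarrow> 1 - 0"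
    using A_top by (intro tendsto_intros tendsto_inverse_0_at_top)
  ultimately have "s \<longlonglongrightarrow> 1"
    by (intro tendsto_sandwich[of "\<lambda>M. 1 - inverse (A M)" s _ "\<lambda>_. 1"]) auto
  then show ?thesis by (simp add: sums_def s_def[abs_def] sum.atLeast1_atMost_eq)
qed

lemma tail_Suc:
  assumes "(\<lambda>n. f (Suc n)) sums 1"
  shows "tail f (Suc k) = 1 - (\<Sum>j<k. f (Suc j))"
proof -
  have "tail f (Suc k) = (\<Sum>n. f (Suc (n + k)))" by (simp add: tail_def add.commute)
  then show ?thesis
    using suminf_minus_initial_segment[OF sums_summable[OF assms], of k] sums_unique[OF assms] by simp
qed

lemma tail_lifetime:
  assumes eq: "renewal_equation u f" and sm: "(\<lambda>n. f (Suc n)) sums 1"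
  shows "decseq (\<lambda>k. tail f (Suc k))" and "0 \<le> tail f (Suc k)" and "tail f (Suc 0) = 1"
proof -
  have f: "0 \<le> f (Suc n)" for n using eq by (simp add: renewal_equation_def)
  show "decseq (\<lambda>k. tail f (Suc k))"
    unfolding decseq_Suc_iff by (simp add: tail_Suc[OF sm] f)
  show "0 \<le> tail f (Suc k)"
    using sum_le_suminf[OF sums_summable[OF sm], of "{..<k}"] f sums_unique[OF sm]
    by (simp add: tail_Suc[OF sm])
  show "tail f (Suc 0) = 1" by (simp add: tail_Suc[OF sm])
qed

text \<open>Decomposition by the last renewal up to time \<open>n\<close>: it happens at
  \<open>n - j\<close> and the next lifetime exceeds \<open>j\<close>. In the induction, passing
  from \<open>n\<close> to \<open>n + 1\<close> changes the sum by \<open>u (Suc n)\<close> minus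
  its renewal expansion, that is by 0.\<close>

lemma tail_convolution_renewal:
  assumes eq: "renewal_equation u f" and "u 0 = 1" and sm: "(\<lambda>n. f (Suc n)) sums 1"
  shows "(\<Sum>j\<le>n. tail f (Suc j) * u (n - j)) = 1"
proof (induction n)
  case 0
  show ?case using assms by (simp add: tail_Suc[OF sm, of 0])
next
  case (Suc n)
  have "(\<Sum>j\<le>Suc n. tail f (Suc j) * u (Suc n - j))
      = u (Suc n) + (\<Sum>j\<le>n. tail f (Suc (Suc j)) * u (n - j))"
    by (subst sum.atMost_Suc_shift) (simp add: tail_Suc[OF sm, of 0])
  also have "\<dots> = u (Suc n) + (\<Sum>j\<le>n. tail f (Suc j) * u (n - j)) - (\<Sum>j\<le>n. f (Suc j) * u (n - j))"
    by (simp add: tail_Suc[OF sm] algebra_simps sum_subtractf sum.distrib)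
  also have "(\<Sum>j\<le>n. f (Suc j) * u (n - j)) = u (Suc n)"
    using eq by (simp add: renewal_equation_def sum.atLeast1_atMost_eq lessThan_Suc_atMost)
  finally show ?case using Suc by simp
qed

section \<open>The lifetime generating function on the closed disk\<close>

text \<open>Real parts give a vanishing sum of the nonnegative terms f_r (1 - Re z^r), so z^r = 1
  whenever f_r > 0. Each n with u_n > 0 is a sum of such r, so z^n = 1, and the multiplicative order
  of z divides a gcd that equals 1.\<close>

lemma renewal_power_series_eq_1_imp:
  fixes z :: complex
  assumes u: "renewal_sequence u" and ap: "aperiodic u" and eq: "renewal_equation u f"
    and sm: "(\<lambda>n. f (Suc n)) sums 1" and z: "norm z \<le> 1"
    and F: "(\<Sum>n. of_real (f (Suc n)) * z ^ Suc n) = 1"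
  shows "z = 1"
proof -
  have fnn: "0 \<le> f r" if "1 \<le> r" for r using eq that by (auto simp: renewal_equation_def)
  have unn: "0 \<le> u n" for n using u by (auto simp: renewal_sequence_def)
  have zk: "norm (z ^ k) \<le> 1" for k using z by (simp add: norm_power power_le_one)
  have smF: "summable (\<lambda>n. of_real (f (Suc n)) * z ^ Suc n)"
    by (rule summable_comparison_test'[OF sums_summable[OF sm], of 0])
       (use fnn zk in \<open>auto simp: norm_mult intro!: mult_left_le simp del: power_Suc\<close>)
  have "(\<lambda>n. Re (of_real (f (Suc n)) * z ^ Suc n)) sums Re 1"
    using sums_Re[OF summable_sums[OF smF]] F by simp
  then have "(\<lambda>n. f (Suc n) * Re (z ^ Suc n)) sums 1" by (simp del: power_Suc)
  from sums_diff[OF sm this]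
  have "(\<lambda>n. f (Suc n) * (1 - Re (z ^ Suc n))) sums 0" by (simp add: algebra_simps del: power_Suc)
  moreover have "0 \<le> f (Suc n) * (1 - Re (z ^ Suc n))" for n
    using fnn complex_Re_le_cmod[of "z ^ Suc n"] zk[of "Suc n"]
    by (intro mult_nonneg_nonneg) (auto simp del: power_Suc)
  ultimately have zero: "f (Suc n) * (1 - Re (z ^ Suc n)) = 0" for n
    using suminf_eq_zero_iff[of "\<lambda>n. f (Suc n) * (1 - Re (z ^ Suc n))"] unfolding sums_iff by blast
  have zf: "z ^ r = 1" if "1 \<le> r" "0 < f r" for r
  proof -
    obtain n where "r = Suc n" using \<open>1 \<le> r\<close> by (auto simp: Suc_le_eq gr0_conv_Suc)
    then have Re: "Re (z ^ r) = 1" using zero[of n] that by (auto simp del: power_Suc)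
    then have "1 + (Im (z ^ r))\<^sup>2 \<le> 1"
      using zk[of r] cmod_power2[of "z ^ r"] power_le_one[of "norm (z ^ r)" 2] by simp
    then show ?thesis using Re by (simp add: complex_eq_iff)
  qed
  have zu: "z ^ n = 1" if "0 < u n" for n
    using that
  proof (induction n rule: less_induct)
    case (less n)
    show ?case
    proof (cases "n = 0")
      case False
      then have "0 < (\<Sum>r=1..n. f r * u (n - r))"
        using eq less by (auto simp: renewal_equation_def)
      then obtain r where r: "r \<in> {1..n}" "0 < f r * u (n - r)"
        by (metis (no_types, lifting) not_le sum_nonpos)
      then have "0 < f r" "0 < u (n - r)"
        using fnn[of r] unn[of "n - r"] by (auto simp: zero_less_mult_iff)
      then have "z ^ r * z ^ (n - r) = 1" using zf[of r] less.IH[of "n - r"] r by simp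
      then show ?thesis using r by (simp flip: power_add)
    qed simp
  qed
  \<comment> \<open>The Gcd of the empty set is 0, so aperiodicity provides a positive exponent;
    hence \<open>z\<close> has a finite order, the \<open>m\<close> below.\<close>
  have "{n. n \<ge> 1 \<and> u n > 0} \<noteq> {}" using ap unfolding aperiodic_def by (metis Gcd_empty zero_neq_one)
  then have ex: "\<exists>n. 1 \<le> n \<and> z ^ n = 1" using zu by blast
  define m where "m = (LEAST n. 1 \<le> n \<and> z ^ n = 1)"
  have m: "1 \<le> m" "z ^ m = 1" using LeastI_ex[OF ex] by (auto simp: m_def)
  have "m dvd n" if "z ^ n = 1" for n
  proof (rule ccontr)
    assume "\<not> m dvd n"
    then have "1 \<le> n mod m" by (simp add: dvd_eq_mod_eq_0)
    moreover have "z ^ (n mod m) = 1"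
    proof -
      have "z ^ n = (z ^ m) ^ (n div m) * z ^ (n mod m)"
        by (metis div_mult_mod_eq mult.commute power_add power_mult)
      then show ?thesis using m that by simp
    qed
    ultimately have "m \<le> n mod m" unfolding m_def by (intro Least_le) auto
    then show False using m mod_less_divisor[of m n] by linarith
  qed
  then have "m dvd Gcd {n. n \<ge> 1 \<and> u n > 0}" using zu by (intro Gcd_greatest) auto
  then show ?thesis using m ap by (simp add: aperiodic_def)
qed

text \<open>With \<open>f\<close> as summable majorant the series \<open>F\<close> is continuous up
  to the boundary, so |1 - F|, which can vanish only at 1, attains a positive minimum on the compact
  set \<open>K\<close>.\<close>

lemma renewal_power_series_away_from_1:
  assumes u: "renewal_sequence u" and ap: "aperiodic u" and eq: "renewal_equation u f"
    and sm: "(\<lambda>n. f (Suc n)) sums 1" and "0 < \<epsilon>"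
  shows "\<exists>\<delta>>0. \<forall>z::complex. norm z \<le> 1 \<and> \<epsilon> \<le> dist z 1 \<longrightarrow>
           \<delta> \<le> norm (1 - (\<Sum>n. of_real (f (Suc n)) * z ^ Suc n))"
proof -
  define F where "F z = (\<Sum>n. of_real (f (Suc n)) * z ^ Suc n)" for z :: complex
  define K where "K = cball 0 1 - ball (1::complex) \<epsilon>"
  have fnn: "0 \<le> f r" if "1 \<le> r" for r using eq that by (auto simp: renewal_equation_def)
  have "uniform_limit (cball 0 1) (\<lambda>n z. \<Sum>i<n. of_real (f (Suc i)) * z ^ Suc i) F sequentially"
    unfolding F_def
  proof (rule Weierstrass_m_test)
    fix n and z :: complex assume "z \<in> cball 0 1"
    then have "norm (z ^ Suc n) \<le> 1" by (simp add: norm_power power_le_one del: power_Suc)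
    then show "norm (of_real (f (Suc n)) * z ^ Suc n) \<le> f (Suc n)"
      using fnn[of "Suc n"] unfolding norm_mult by (simp add: mult_left_le del: power_Suc)
  qed (use sm in \<open>auto simp: sums_iff\<close>)
  then have "continuous_on (cball 0 1) F"
    by (rule uniform_limit_theorem[rotated]) (auto intro!: always_eventually continuous_intros)
  then have "continuous_on K (\<lambda>z. norm (1 - F z))"
    unfolding K_def by (intro continuous_intros) (auto elim: continuous_on_subset)
  moreover have "compact K" unfolding K_def by (intro compact_diff) auto
  moreover have "1 - F z \<noteq> 0" if "z \<in> K" for z
    using renewal_power_series_eq_1_imp[OF u ap eq sm, of z] that \<open>0 < \<epsilon>\<close>
    by (auto simp: K_def F_def)
  \<comment> \<open>\<open>K\<close> is empty when \<open>\<epsilon> > 2\<close>; then 1 serves as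
    \<open>\<delta>\<close>.\<close>
  ultimately have "\<exists>\<delta>>0. \<forall>z\<in>K. \<delta> \<le> norm (1 - F z)"
  proof (cases "K = {}")
    case False
    assume "continuous_on K (\<lambda>z. norm (1 - F z))" "compact K" and ne: "\<And>z. z \<in> K \<Longrightarrow> 1 - F z \<noteq> 0"
    with False obtain w where "w \<in> K" "\<forall>z\<in>K. norm (1 - F w) \<le> norm (1 - F z)"
      using continuous_attains_inf by blast
    then show ?thesis using ne[of w] by (intro exI[of _ "norm (1 - F w)"]) auto
  qed (auto intro: exI[of _ 1])
  then show ?thesis by (auto simp: K_def F_def dist_commute)
qed

section \<open>Generating functions of tails and increments\<close>

text \<open>Consecutive tails differ by one value of \<open>f\<close>, so the product telescopes
  coefficientwise. This carries lower bounds for |1 - F| over to the tail series.\<close>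

lemma tail_power_series:
  fixes z :: complex
  assumes eq: "renewal_equation u f" and sm: "(\<lambda>n. f (Suc n)) sums 1"
    and c: "\<And>k. \<bar>tail f (Suc k)\<bar> \<le> 1" and z: "norm z < 1"
  shows "(1 - z) * (\<Sum>k. of_real (tail f (Suc k)) * z ^ k) = 1 - (\<Sum>n. of_real (f (Suc n)) * z ^ Suc n)"
proof -
  define a :: "nat \<Rightarrow> complex" where "a k = of_real (tail f (Suc k)) * z ^ k" for k
  have "summable a"
    unfolding a_def using summable_bounded_power_series[OF c z] by (rule summable_norm_cancel)
  then have a: "a sums suminf a" by (rule summable_sums)
  have "(\<lambda>k. z * a k - a (Suc k)) sums (z * suminf a - (suminf a - a 0))"
    using a by (intro sums_diff sums_mult) (simp_all add: sums_Suc_iff)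
  moreover have "z * a k - a (Suc k) = of_real (f (Suc k)) * z ^ Suc k" for k
    by (simp add: a_def tail_Suc[OF sm] algebra_simps)
  moreover have "a 0 = 1" by (simp add: a_def tail_Suc[OF sm])
  ultimately have "(\<Sum>n. of_real (f (Suc n)) * z ^ Suc n) = z * suminf a - (suminf a - 1)"
    by (simp add: sums_iff)
  then have "(1 - z) * suminf a = 1 - (\<Sum>n. of_real (f (Suc n)) * z ^ Suc n)"
    by (simp add: algebra_simps)
  then show ?thesis unfolding a_def .
qed

text \<open>\<open>v\<close> is the difference sequence of \<open>u\<close> continued by 0 to index
  -1. Differencing the constant convolution 1 leaves the unit sequence 1, 0, 0, ..., and the Cauchy
  product translates this into series.\<close>

lemma convolution_inverse_power_series:
  fixes c u :: "nat \<Rightarrow> real" and z :: complex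
  defines "v \<equiv> \<lambda>n. if n = 0 then u 0 else u n - u (n - 1)"
  assumes conv: "\<And>n. (\<Sum>j\<le>n. c j * u (n - j)) = 1"
    and "\<And>k. \<bar>c k\<bar> \<le> K" "\<And>k. \<bar>v k\<bar> \<le> K'" "norm z < 1"
  shows "(\<Sum>k. of_real (c k) * z ^ k) * (\<Sum>k. of_real (v k) * z ^ k) = 1"
proof -
  have cv: "(\<Sum>j\<le>n. c j * v (n - j)) = (if n = 0 then 1 else 0)" for n
  proof (cases n)
    case (Suc m)
    have "(\<Sum>j\<le>Suc m. c j * v (Suc m - j))
        = (\<Sum>j\<le>m. c j * u (Suc m - j) - c j * u (m - j)) + c (Suc m) * u 0"
      by (auto simp: v_def Suc_diff_le algebra_simps intro!: sum.cong)
    also have "\<dots> = (\<Sum>j\<le>Suc m. c j * u (Suc m - j)) - (\<Sum>j\<le>m. c j * u (m - j))"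
      by (simp add: sum_subtractf)
    finally show ?thesis by (simp only: conv Suc) simp
  qed (use conv[of 0] in \<open>simp add: v_def\<close>)
  have "(\<Sum>k. of_real (c k) * z ^ k) * (\<Sum>k. of_real (v k) * z ^ k)
      = (\<Sum>n. \<Sum>j\<le>n. (of_real (c j) * z ^ j) * (of_real (v (n - j)) * z ^ (n - j)))"
    using summable_bounded_power_series[OF assms(3,5)] summable_bounded_power_series[OF assms(4,5)]
    by (rule Cauchy_product)
  also have "\<dots> = (\<Sum>n. of_real (\<Sum>j\<le>n. c j * v (n - j)) * z ^ n)"
    unfolding of_real_sum sum_distrib_right
  proof (intro suminf_cong sum.cong refl)
    fix n j :: nat assume "j \<in> {..n}"
    then have "z ^ j * z ^ (n - j) = z ^ n" by (simp flip: power_add)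
    then show "(of_real (c j) * z ^ j) * (of_real (v (n - j)) * z ^ (n - j))
        = of_real (c j * v (n - j)) * z ^ n" by (simp add: mult_ac)
  qed
  also have "\<dots> = (\<Sum>n. if n = 0 then 1 else 0)"
    by (intro suminf_cong) (simp add: cv)
  also have "\<dots> = 1" using sums_single[of 0 "\<lambda>_. 1::complex"] by (simp add: sums_iff)
  finally show ?thesis .
qed

section \<open>Growth of the partial sums\<close>

text \<open>Adding the identities up to \<open>n\<close> sums \<open>c i * u j\<close> over the
  triangle \<open>i + j \<le> n\<close>, which lies in the square that the product of the partial
  sums covers.\<close>

lemma convolution_partial_sums_lower_bound:
  fixes c u :: "nat \<Rightarrow> real"
  assumes "\<And>n. (\<Sum>j\<le>n. c j * u (n - j)) = 1" "\<And>k. 0 \<le> c k" "\<And>k. 0 \<le> u k"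
  shows "real (Suc n) \<le> (\<Sum>k\<le>n. c k) * (\<Sum>k\<le>n. u k)"
proof -
  have "real (Suc n) = (\<Sum>m\<le>n. \<Sum>j\<le>m. c j * u (m - j))" by (simp add: assms(1))
  also have "\<dots> = (\<Sum>(i, j)\<in>{(i, j). i + j \<le> n}. c i * u j)"
    by (rule sum.triangle_reindex_eq[symmetric])
  also have "\<dots> \<le> (\<Sum>(i, j)\<in>{..n} \<times> {..n}. c i * u j)"
    using assms by (intro sum_mono2) auto
  finally show ?thesis by (simp add: sum_product sum.cartesian_product)
qed

text \<open>\<open>L(N)\<^sup>3 / N\<close> is eventually nonincreasing, because \<open>1 - x \<le> (1 - x/3)\<^sup>3\<close>.\<close>

lemma tail_sum_growth:
  fixes c :: "nat \<Rightarrow> real"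
  assumes nn: "\<And>k. 0 \<le> c k"
    and ratio: "\<And>N. N \<ge> N0 \<Longrightarrow> real (Suc N) * c N \<le> 1/3 * (\<Sum>k\<le>N. c k)"
  shows "\<exists>C. \<forall>\<^sub>F N in sequentially. (\<Sum>k\<le>N. c k) ^ 3 \<le> C * real (Suc N)"
proof -
  define L where "L N = (\<Sum>k\<le>N. c k)" for N
  have L: "0 \<le> L N" for N by (simp add: L_def nn sum_nonneg)
  have decreasing: "L (Suc N) ^ 3 / real (Suc (Suc N)) \<le> L N ^ 3 / real (Suc N)" if "N0 \<le> N" for N
  proof -
    \<comment> \<open>The ratio condition at \<open>Suc N\<close> says that the last term is at most
      the fraction \<open>x / 3\<close> of \<open>L (Suc N)\<close>, while \<open>1 - x\<close> is
      the quotient of the two denominators.\<close>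
    define x where "x = 1 / real (Suc (Suc N))"
    have x: "0 \<le> x" "x \<le> 1" "real (Suc N) = real (Suc (Suc N)) * (1 - x)"
      by (auto simp: x_def field_simps)
    have "c (Suc N) \<le> x / 3 * L (Suc N)"
      using ratio[of "Suc N"] that by (simp add: x_def L_def field_simps)
    then have "L (Suc N) * (1 - x / 3) \<le> L N" by (simp add: L_def algebra_simps)
    then have "(L (Suc N) * (1 - x / 3)) ^ 3 \<le> L N ^ 3" using L x by (intro power_mono) auto
    moreover have "1 - x \<le> (1 - x / 3) ^ 3"
    proof -
      have "(1 - x / 3) ^ 3 - (1 - x) = x ^ 2 * (9 - x) / 27"
        by (simp add: power2_eq_square power3_eq_cube field_simps)
      moreover have "0 \<le> x ^ 2 * (9 - x) / 27" using x by simp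
      ultimately show ?thesis by linarith
    qed
    then have "L (Suc N) ^ 3 * (1 - x) \<le> L (Suc N) ^ 3 * (1 - x / 3) ^ 3"
      using L by (intro mult_left_mono) auto
    ultimately have "L (Suc N) ^ 3 * (1 - x) \<le> L N ^ 3" by (simp add: power_mult_distrib)
    moreover have "1 - x = real (Suc N) / real (Suc (Suc N))" by (simp add: x_def field_simps)
    ultimately show ?thesis by (simp add: field_simps)
  qed
  define C where "C = L N0 ^ 3 / real (Suc N0)"
  have "L N ^ 3 / real (Suc N) \<le> C" if "N \<ge> N0" for N
    using that
  proof (induction N rule: dec_induct)
    case (step n)
    then show ?case using decreasing[of n] by linarith
  qed (simp add: C_def)
  then have "L N ^ 3 \<le> C * real (Suc N)" if "N \<ge> N0" for N
    using that by (simp add: field_simps)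
  then show ?thesis unfolding L_def eventually_sequentially by blast
qed

section \<open>Square summable increments and the conclusion\<close>

lemma renewal_increments_square_bounded:
  assumes u: "renewal_sequence u" and ap: "aperiodic u" and eq: "renewal_equation u f"
    and sm: "(\<lambda>n. f (Suc n)) sums 1"
    and ratio: "\<And>N. N \<ge> N0 \<Longrightarrow> real N * tail f (Suc N) \<le> 1/3 * (\<Sum>k<N. tail f (Suc k))"
  shows "\<exists>B\<ge>0. \<forall>m. (\<Sum>k<m. (u k - u (k + 1))\<^sup>2) \<le> B\<^sup>2"
proof -
  define c where "c k = tail f (Suc k)" for k
  define v where "v n = (if n = 0 then u 0 else u n - u (n - 1))" for n
  define V where "V z = (\<Sum>k. of_real (v k) * z ^ k)" for z :: complex
  have u01: "0 \<le> u n" "u n \<le> 1" and u0: "u 0 = 1" for n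
    using u by (auto simp: renewal_sequence_def)
  have v1: "\<bar>v k\<bar> \<le> 1" for k
    using u01[of k] u01[of "k - 1"] by (auto simp: v_def)
  have dec: "decseq c" and nn: "\<And>k. 0 \<le> c k" and c0: "c 0 = 1"
    using tail_lifetime[OF eq sm] by (auto simp: c_def[abs_def])
  have c1: "\<bar>c k\<bar> \<le> 1" for k using nn[of k] decseqD[OF dec, of 0 k] c0 by simp
  have conv: "(\<Sum>j\<le>n. c j * u (n - j)) = 1" for n
    unfolding c_def by (rule tail_convolution_renewal[OF eq u0 sm])
  obtain \<epsilon> where \<epsilon>: "\<epsilon> > 0"
    "\<And>z. norm z < 1 \<Longrightarrow> dist z 1 < \<epsilon> \<Longrightarrow> 1/90 \<le> Re (\<Sum>k. of_real (c k) * z ^ k)"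
    using Re_power_series_lower_bound_near_1[OF dec nn c0, of N0] ratio by (auto simp: c_def)
  obtain \<delta> where \<delta>: "\<delta> > 0"
    "\<And>z::complex. norm z \<le> 1 \<Longrightarrow> \<epsilon> \<le> dist z 1 \<Longrightarrow> \<delta> \<le> norm (1 - (\<Sum>n. of_real (f (Suc n)) * z ^ Suc n))"
    using renewal_power_series_away_from_1[OF u ap eq sm \<epsilon>(1)] by blast
  \<comment> \<open>90 inverts the bound near 1. Elsewhere \<open>\<delta>\<close> is at most |1 -
    z| |C|, hence at most 2 |C|.\<close>
  define B where "B = max 90 (2 / \<delta>)"
  have "norm (V z) \<le> B" if z: "norm z < 1" for z
  proof -
    define C where "C = (\<Sum>k. of_real (c k) * z ^ k)"
    have "C * V z = 1"
      unfolding C_def V_def v_def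
      by (rule convolution_inverse_power_series[OF conv c1 v1[unfolded v_def] z])
    then have V: "norm (V z) = 1 / norm C"
      by (metis norm_divide norm_one nonzero_eq_divide_eq mult.commute mult_zero_left zero_neq_one)
    show ?thesis
    proof (cases "dist z 1 < \<epsilon>")
      case True
      then have "1/90 \<le> norm C" using \<epsilon>(2)[OF z True] complex_Re_le_cmod[of C] by (simp add: C_def)
      then have "1 / norm C \<le> 1 / (1/90)" by (intro divide_left_mono) auto
      then show ?thesis by (simp add: V B_def)
    next
      case False
      then have "\<delta> \<le> norm ((1 - z) * C)"
        unfolding C_def c_def using \<delta>(2)[of z] z tail_power_series[OF eq sm c1[unfolded c_def] z] by simp
      also have "\<dots> \<le> 2 * norm C"
        unfolding norm_mult using z norm_triangle_ineq4[of 1 z] by (intro mult_right_mono) auto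
      finally have C: "\<delta> / 2 \<le> norm C" by simp
      then have "1 / norm C \<le> 1 / (\<delta> / 2)" using \<delta>(1) by (intro divide_left_mono mult_pos_pos) linarith+
      then show ?thesis by (simp add: V B_def)
    qed
  qed
  then have V2: "(\<Sum>k<m. (v k)\<^sup>2) \<le> B\<^sup>2" for m
    unfolding V_def by (intro sum_squares_le_sup_power_series[OF v1]) auto
  have "(\<Sum>k<m. (u k - u (k + 1))\<^sup>2) \<le> B\<^sup>2" for m
  proof -
    have "(\<Sum>k<m. (u k - u (k + 1))\<^sup>2) = (\<Sum>k<m. (v (Suc k))\<^sup>2)"
      by (simp add: v_def power2_commute)
    also have "\<dots> \<le> (\<Sum>k<Suc m. (v k)\<^sup>2)" by (subst sum.lessThan_Suc_shift) simp
    finally show ?thesis using V2 order_trans by blast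
  qed
  moreover have "0 \<le> B" by (simp add: B_def)
  ultimately show ?thesis by blast
qed

theorem mainTheorem3:
  fixes u f :: "nat \<Rightarrow> real"
  assumes "renewal_sequence u"
    and "aperiodic u"
    and "recurrent u"
    and "lifetime_distribution u f"
    and "limsup (\<lambda>N. ereal (real N * tail f N / tail_sum f N)) < ereal (1 / (sqrt 5 + 1))"
  shows "smooth_sequence u"
proof -
  have eq: "renewal_equation u f" using assms(4) by (simp add: lifetime_distribution_def)
  note sm = recurrent_lifetime_sums_1[OF assms(1,3) eq]
  have u01: "0 \<le> u n" "u n \<le> 1" and u0: "u 0 = 1" for n
    using assms(1) by (auto simp: renewal_sequence_def)
  define c where "c k = tail f (Suc k)" for k
  \<comment> \<open>Indices are shifted by one: \<open>L n\<close> is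
    \<open>tail_sum f (Suc n)\<close>.\<close>
  define L where "L n = (\<Sum>k\<le>n. c k)" for n
  define A where "A n = (\<Sum>k\<le>n. u k)" for n
  have nn: "\<And>k. 0 \<le> c k" and c0: "c 0 = 1"
    using tail_lifetime[OF eq sm] by (auto simp: c_def)
  \<comment> \<open>The value 1/3 meets both demands on the ratio: 2 * (1/3) < sin(pi/4) for the
    bound near 1, and 1/3 < 1/2 for the comparison of a_n with sqrt n.\<close>
  have "2 < sqrt 5" by (rule real_less_rsqrt) simp
  then have "1 / (sqrt 5 + 1) < 1 / 3" by (simp add: field_simps)
  moreover have "\<forall>\<^sub>F N in sequentially. real N * tail f N / tail_sum f N < 1 / (sqrt 5 + 1)"
    using Limsup_lessD[OF assms(5)] by simp
  ultimately have "\<forall>\<^sub>F N in sequentially. real N * tail f N / tail_sum f N < 1/3"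
    by (elim eventually_mono) linarith
  then obtain N0 where N0: "\<And>N. N \<ge> N0 \<Longrightarrow> real N * tail f N / tail_sum f N < 1/3"
    by (auto simp: eventually_sequentially)
  have ratio: "real (Suc N) * c N \<le> 1/3 * (\<Sum>k\<le>N. c k)" if "N \<ge> N0" for N
  proof -
    have "tail_sum f (Suc N) = (\<Sum>k\<le>N. c k)"
      unfolding tail_sum_def c_def lessThan_Suc_atMost[symmetric] by (simp add: sum.atLeast1_atMost_eq)
    \<comment> \<open>As \<open>c 0 = 1\<close>, the denominator is positive and the quotient can be
      multiplied out.\<close>
    moreover have "c 0 \<le> (\<Sum>k\<le>N. c k)" using nn by (intro member_le_sum) auto
    ultimately show ?thesis using N0[of "Suc N"] that c0 by (simp add: c_def field_simps)
  qed
  \<comment> \<open>Cutting strictly before \<open>N\<close> removes \<open>c N\<close> on the left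
    but only a third of it on the right.\<close>
  have "real N * tail f (Suc N) \<le> 1/3 * (\<Sum>k<N. tail f (Suc k))" if "N \<ge> N0" for N
  proof -
    have "(\<Sum>k\<le>N. c k) = (\<Sum>k<N. c k) + c N" unfolding lessThan_Suc_atMost[symmetric] by simp
    then show ?thesis using ratio[OF that] nn[of N] unfolding c_def by (simp add: algebra_simps)
  qed
  from renewal_increments_square_bounded[OF assms(1,2) eq sm this]
  obtain B where B: "B \<ge> 0" "\<And>m. (\<Sum>k<m. (u k - u (k + 1))\<^sup>2) \<le> B\<^sup>2" by blast
  have increments: "(\<Sum>k=1..n. \<bar>u k - u (k + 1)\<bar>) \<le> B * sqrt (real n)" for n
  proof -
    have "(\<Sum>k=1..n. \<bar>u k - u (k + 1)\<bar>\<^sup>2) \<le> (\<Sum>k<Suc n. (u k - u (k + 1))\<^sup>2)"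
      by (subst power2_abs) (rule sum_mono2, auto)
    also have "\<dots> \<le> B\<^sup>2" by (rule B(2))
    finally have "real n * (\<Sum>k=1..n. \<bar>u k - u (k + 1)\<bar>\<^sup>2) \<le> real n * B\<^sup>2"
      by (intro mult_left_mono) auto
    moreover have "(\<Sum>k=1..n. 1 * \<bar>u k - u (k + 1)\<bar>)\<^sup>2
        \<le> (\<Sum>k=1..n. 1\<^sup>2) * (\<Sum>k=1..n. \<bar>u k - u (k + 1)\<bar>\<^sup>2)"
      by (rule Cauchy_Schwarz_ineq_sum)
    ultimately have "(\<Sum>k=1..n. \<bar>u k - u (k + 1)\<bar>)\<^sup>2 \<le> (B * sqrt (real n))\<^sup>2"
      by (simp add: power_mult_distrib mult.commute)
    then show ?thesis by (rule power2_le_imp_le) (use B in simp)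
  qed
  obtain C0 where C0: "\<forall>\<^sub>F N in sequentially. L N ^ 3 \<le> C0 * real (Suc N)"
    using tail_sum_growth[OF nn ratio] unfolding L_def by blast
  define C where "C = max C0 1"
  have C: "C > 0" by (simp add: C_def)
  \<comment> \<open>From (n+1)^3 <= L^3 A^3 <= C (n+1) A^3, solved for \<open>A\<close>; the final 1
    is \<open>u 0\<close>, which a_n omits. Thus \<open>g\<close> has order n^(2/3) and dominates
    sqrt n.\<close>
  define g where "g n = (real (Suc n) ^ 2 / C) powr (1/3) - 1" for n
  have "\<forall>\<^sub>F n in sequentially. g n \<le> (\<Sum>k=1..n. u k)"
    using C0
  proof eventually_elim
    case (elim n)
    have "real (Suc n) \<le> L n * A n"
      unfolding L_def A_def
      by (rule convolution_partial_sums_lower_bound[OF _ nn u01(1)])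
         (unfold c_def, rule tail_convolution_renewal[OF eq u0 sm])
    then have "real (Suc n) ^ 3 \<le> (L n * A n) ^ 3" by (intro power_mono) auto
    also have "\<dots> \<le> (C * real (Suc n)) * A n ^ 3"
      unfolding power_mult_distrib
    proof (rule mult_right_mono)
      have "C0 * real (Suc n) \<le> C * real (Suc n)" by (intro mult_right_mono) (auto simp: C_def)
      then show "L n ^ 3 \<le> C * real (Suc n)" using elim by linarith
    qed (simp add: A_def u01 sum_nonneg)
    finally have "real (Suc n) * real (Suc n) ^ 2 \<le> real (Suc n) * (C * A n ^ 3)"
      by (simp add: power3_eq_cube power2_eq_square mult_ac del: of_nat_Suc)
    then have "real (Suc n) ^ 2 / C \<le> A n ^ 3"
      using C by (simp add: mult_le_cancel_left_pos field_simps del: of_nat_Suc)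
    then have "(real (Suc n) ^ 2 / C) powr (1/3) \<le> (A n ^ 3) powr (1/3)"
      using C by (intro powr_mono2) auto
    also have "A n \<ge> 1"
      unfolding A_def using member_le_sum[of 0 "{..n}" u] u01 u0 by auto
    then have "(A n ^ 3) powr (1/3) = A n" by (simp add: powr_powr flip: powr_numeral)
    also have "A n = (\<Sum>k=1..n. u k) + 1"
      by (simp add: A_def sum.atMost_shift u0 sum.atLeast1_atMost_eq)
    finally show ?case by (simp add: g_def)
  qed
  moreover have "\<forall>\<^sub>F n in sequentially. 0 \<le> g n"
    unfolding g_def using C by real_asymp
  ultimately have "\<forall>\<^sub>F n in sequentially. norm (g n) \<le> 1 * norm (\<Sum>k=1..n. u k)"
    by eventually_elim simp
  then have "g \<in> O(\<lambda>n. \<Sum>k=1..n. u k)" by (rule bigoI)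
  moreover have "(\<lambda>n. sqrt (real n)) \<in> o(g)"
    unfolding g_def using C by real_asymp
  moreover have "(\<lambda>n. \<Sum>k=1..n. \<bar>u k - u (k + 1)\<bar>) \<in> O(\<lambda>n. sqrt (real n))"
    using increments by (intro bigoI[of _ B]) auto
  ultimately show ?thesis
    unfolding smooth_sequence_def
    by (blast intro: landau_o.big_small_trans landau_o.small_big_trans)
qed

end
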